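(* Let $X$ be a non-negative absolutely continuous random variable with cumulative distribution function $F$ and finite mean $\mathbb{E}(X)$, and suppose that $\lim_{x\to+\infty} -xF(x)\log F(x)=0$. Then the cumulative entropy of $X$ satisfies $$\mathcal{CE}(X)=-\sum_{n=1}^{+\infty}\frac{1}{n(n+1)}\,\mu_{1:n+1}+\mathbb{E}(X),$$ where $\mu_{1:n+1}$ is the mean of the smallest order statistic in a sample of size $n+1$ from $F$.
   Context: $\log$ is the natural logarithm, with the convention $0\log 0=0$. The cumulative entropy of a non-negative absolutely continuous random variable $X$ with cumulative distribution function $F$ is $\mathcal{CE}(X)=-\int_0^{+\infty}F(x)\log F(x)\,dx$. For i.i.d. random variables $X_1,\dots,X_m$ with the distribution of $X$, $X_{k:m}$ denotes the $k$-th smallest value (the $k$-th order statistic), and $\mu_{k:m}=\mathbb{E}(X_{k:m})$; in particular $\mu_{1:m}=\mathbb{E}(\min(X_1,\dots,X_m))$. *)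

theory Defs
  imports "HOL-Probability.Probability"
begin

text \<open>Since \<open>ln 0 = 0\<close> in the library, the convention \<open>0 log 0 = 0\<close> holds automatically.\<close>

definition cumulative_entropy :: "'a measure \<Rightarrow> ('a \<Rightarrow> real) \<Rightarrow> real" where
  "cumulative_entropy M X =
     - (LBINT x:{0..}. cdf (distr M borel X) x * ln (cdf (distr M borel X) x))"

text \<open>The \<open>k\<close>-th smallest of the values \<open>x 1, \<dots>, x m\<close>, counted with multiplicity,
  where \<open>1 \<le> k \<le> m\<close>.\<close>

definition order_stat :: "nat \<Rightarrow> nat \<Rightarrow> (nat \<Rightarrow> real) \<Rightarrow> real" where
  "order_stat k m x = sort (map x [1..<Suc m]) ! (k - 1)"

text \<open>The i.i.d. sample is realised by the coordinates of a product space; the lemma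
  \<open>mean_order_stat_iid\<close> below shows that any i.i.d. sample gives the same mean.\<close>

definition sample_space :: "'a measure \<Rightarrow> ('a \<Rightarrow> real) \<Rightarrow> nat \<Rightarrow> (nat \<Rightarrow> real) measure" where
  "sample_space M X m = (\<Pi>\<^sub>M i\<in>{1..m}. distr M borel X)"

definition mean_order_stat :: "'a measure \<Rightarrow> ('a \<Rightarrow> real) \<Rightarrow> nat \<Rightarrow> nat \<Rightarrow> real" where
  "mean_order_stat M X k m = (\<integral>x. order_stat k m x \<partial>sample_space M X m)"

lemma order_stat_1: "m \<ge> 1 \<Longrightarrow> order_stat 1 m x = Min (x ` {1..m})"
proof -
  assume m: "m \<ge> 1"
  let ?l = "sort (map x [1..<Suc m])"
  have s: "set ?l = x ` {1..m}" by (auto simp: atLeastLessThanSuc_atLeastAtMost)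
  have ne: "?l \<noteq> []" using m by (metis s image_is_empty atLeastatMost_empty_iff2 list.set(1) not_less)
  have "?l ! 0 = Min (set ?l)"
  proof (rule sym, rule Min_eqI)
    show "?l ! 0 \<in> set ?l" using ne nth_mem length_greater_0_conv by blast
    show "?l ! 0 \<le> y" if "y \<in> set ?l" for y
      using that sorted_nth_mono[of ?l 0] by (metis in_set_conv_nth le0 sorted_sort)
  qed (rule finite_set)
  then show ?thesis by (simp only: order_stat_def s diff_self_eq_0)
qed

lemma sorted_nth_le_iff:
  fixes a :: real
  assumes "sorted xs" "j < length xs"
  shows "xs ! j \<le> a \<longleftrightarrow> j < length (filter (\<lambda>y. y \<le> a) xs)"
  using assms
proof (induction xs arbitrary: j)
  case (Cons y ys)
  show ?case
  proof (cases "y \<le> a")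
    case True
    then show ?thesis using Cons by (cases j) auto
  next
    case False
    then have "\<forall>z\<in>set (y # ys). \<not> z \<le> a" using Cons.prems(1) by fastforce
    moreover from this have "filter (\<lambda>z. z \<le> a) (y # ys) = []" by (simp add: filter_empty_conv)
    ultimately show ?thesis using Cons.prems(2) by (metis list.size(3) not_less_zero nth_mem)
  qed
qed simp

lemma order_stat_le_iff:
  assumes "1 \<le> k" "k \<le> m"
  shows "order_stat k m x \<le> a \<longleftrightarrow> real k \<le> (\<Sum>i\<in>{1..m}. indicator {..a} (x i))"
proof -
  let ?l = "map x [1..<Suc m]"
  have "length (filter (\<lambda>y. y \<le> a) (sort ?l)) = length (filter (\<lambda>y. y \<le> a) ?l)"
    by (metis filter_sort length_sort)
  also have "\<dots> = length (filter (\<lambda>i. x i \<le> a) [1..<Suc m])"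
    by (simp only: filter_map length_map o_def)
  also have "\<dots> = card {i \<in> {1..m}. x i \<le> a}"
    by (subst distinct_card[symmetric])
       (auto intro!: arg_cong[where f = card] simp del: upt_Suc)
  finally have eq: "length (filter (\<lambda>y. y \<le> a) (sort ?l)) = card {i \<in> {1..m}. x i \<le> a}" .
  have "(\<Sum>i\<in>{1..m}. indicator {..a} (x i)) = (\<Sum>i\<in>{1..m}. if x i \<le> a then 1 else (0::real))"
    by (intro sum.cong) (auto simp: indicator_def)
  also have "\<dots> = real (card {i \<in> {1..m}. x i \<le> a})"
    by (simp add: sum.If_cases Int_def)
  finally have s: "(\<Sum>i\<in>{1..m}. indicator {..a} (x i)) = real (card {i \<in> {1..m}. x i \<le> a})" .
  show ?thesis
    unfolding order_stat_def s
    by (subst sorted_nth_le_iff, simp, use assms in simp, subst eq, use assms in linarith)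
qed

lemma measurable_order_stat:
  assumes "1 \<le> k" "k \<le> m"
  shows "order_stat k m \<in> borel_measurable (\<Pi>\<^sub>M i\<in>{1..m}. borel)"
  unfolding borel_measurable_iff_le
proof
  fix a
  have [measurable]: "(\<lambda>x. (\<Sum>i\<in>{1..m}. indicator {..a} (x i)) :: real)
      \<in> borel_measurable (\<Pi>\<^sub>M i\<in>{1..m}. borel :: real measure)"
    by (intro borel_measurable_sum) measurable
  show "{w \<in> space (\<Pi>\<^sub>M i\<in>{1..m}. borel). order_stat k m w \<le> a} \<in> sets (\<Pi>\<^sub>M i\<in>{1..m}. borel)"
    unfolding order_stat_le_iff[OF assms] by measurable
qed

lemma mean_order_stat_iid:
  assumes "prob_space N" "1 \<le> k" "k \<le> m"
    and indep: "prob_space.indep_vars N (\<lambda>_. borel) Y {1..m}"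
    and dist: "\<And>i. i \<in> {1..m} \<Longrightarrow> distr N borel (Y i) = distr M borel X"
  shows "(\<integral>\<omega>. order_stat k m (\<lambda>i. Y i \<omega>) \<partial>N) = mean_order_stat M X k m"
proof -
  interpret N: prob_space N by fact
  have rv: "\<And>i. i \<in> {1..m} \<Longrightarrow> Y i \<in> borel_measurable N"
    using indep unfolding N.indep_vars_def by blast
  have ne: "{1..m} \<noteq> {}" using assms(2,3) by auto
  have "distr N (\<Pi>\<^sub>M i\<in>{1..m}. borel) (\<lambda>\<omega>. \<lambda>i\<in>{1..m}. Y i \<omega>) = (\<Pi>\<^sub>M i\<in>{1..m}. distr N borel (Y i))"
    using N.indep_vars_iff_distr_eq_PiM'[of "{1..m}" Y "\<lambda>_. borel"] ne rv indep by blast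
  also have "\<dots> = sample_space M X m"
    unfolding sample_space_def by (intro PiM_cong) (auto simp: dist)
  finally have D: "sample_space M X m =
      distr N (\<Pi>\<^sub>M i\<in>{1..m}. borel) (\<lambda>\<omega>. \<lambda>i\<in>{1..m}. Y i \<omega>)" by simp
  have "mean_order_stat M X k m = (\<integral>\<omega>. order_stat k m (\<lambda>i\<in>{1..m}. Y i \<omega>) \<partial>N)"
    unfolding mean_order_stat_def D
    by (intro integral_distr measurable_restrict rv measurable_order_stat assms)
  also have "\<dots> = (\<integral>\<omega>. order_stat k m (\<lambda>i. Y i \<omega>) \<partial>N)"
    unfolding order_stat_def
    by (intro Bochner_Integration.integral_cong refl arg_cong2[where f = nth]
        arg_cong[where f = sort] map_cong) auto
  finally show ?thesis by simp
qed

end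

theory Submission
  imports Defs
begin

text \<open>
  Write \<open>G = 1 - F\<close> for the survival function. The logarithmic series for \<open>ln (1 - G)\<close>,
  multiplied by \<open>1 - G\<close>, gives the pointwise expansion
  \<open>- F ln F = G - (\<Sum>n\<ge>1. G\<^sup>n\<^sup>+\<^sup>1 / (n (n + 1)))\<close>, which also holds at \<open>F = 0\<close>, where the series
  telescopes (\<open>sums_entropy_expansion\<close>).

  The terms of this expansion are tail probabilities: a sample of size \<open>m\<close> has its minimum above
  \<open>t\<close> exactly when all its members lie above \<open>t\<close>, which by independence has probability \<open>G(t)\<^sup>m\<close>
  (\<open>prob_min_order_stat_greater\<close>). As the mean of a non-negative variable is the integral of its
  tail (\<open>has_bochner_integral_layer_cake\<close>), integration over \<open>[0, \<infinity>)\<close> turns \<open>G\<close> into the mean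
  of \<open>X\<close> and \<open>G\<^sup>n\<^sup>+\<^sup>1\<close> into \<open>\<mu>\<^sub>1\<^sub>:\<^sub>n\<^sub>+\<^sub>1\<close>. Summation and integration may be interchanged
  because \<open>0 \<le> G\<^sup>n\<^sup>+\<^sup>1 \<le> G\<close>, with \<open>G\<close> integrable and \<open>\<Sum>n\<ge>1. 1 / (n (n + 1))\<close> finite.
\<close>

text \<open>
  With \<open>v = 1 - u\<close> and \<open>1 / (k (k + 1)) = 1 / k - 1 / (k + 1)\<close>, the series splits into \<open>v\<close> times
  the series of \<open>- ln (1 - v)\<close>, minus the same series without its first term. Both diverge at
  \<open>u = 0\<close>, but there the terms telescope to \<open>1\<close>, in agreement with \<open>0 ln 0 = 0\<close>.
\<close>

lemma sums_entropy_expansion: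
  fixes u :: real
  assumes "0 \<le> u" "u \<le> 1"
  shows "(\<lambda>n. (1 - u) ^ (n + 2) / (real (Suc n) * real (Suc n + 1))) sums ((1 - u) + u * ln u)"
proof -
  define v where "v = 1 - u"
  have split: "v ^ (n + 2) / (real (Suc n) * real (Suc n + 1))
      = v * (v ^ Suc n / real (Suc n)) - v ^ Suc (Suc n) / real (Suc (Suc n))" for n
    by (simp add: divide_simps) (simp add: algebra_simps)
  show ?thesis
  proof (cases "u = 0")
    case True
    have "(\<lambda>n. inverse (real (Suc n))) \<longlonglongrightarrow> 0"
      by (rule LIMSEQ_inverse_real_of_nat)
    from telescope_sums'[OF this] show ?thesis
      using split True by (simp add: v_def inverse_eq_divide)
  next
    case False
    then have "\<bar>- v\<bar> < 1" using assms by (simp add: v_def)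
    from ln_series'[OF this] have "(\<lambda>n. - (v ^ n) / real n) sums ln u"
      by (simp add: v_def)
    from sums_minus[OF this] have L0: "(\<lambda>n. v ^ n / real n) sums (- ln u)"
      by simp
    then have L1: "(\<lambda>n. v ^ Suc n / real (Suc n)) sums (- ln u)"
      using sums_Suc_iff[of "\<lambda>n. v ^ n / real n"] by simp
    then have L2: "(\<lambda>n. v ^ Suc (Suc n) / real (Suc (Suc n))) sums (- ln u - v)"
      using sums_Suc_iff[of "\<lambda>n. v ^ Suc n / real (Suc n)"] by simp
    show ?thesis
      using sums_diff[OF sums_mult[OF L1, of v] L2]
      unfolding split[symmetric] by (simp add: v_def algebra_simps)
  qed
qed

text \<open>
  Since \<open>Z x\<close> is the length of \<open>[0, Z x)\<close>, the left-hand side is the area under the graph of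
  \<open>Z\<close>; Tonelli's theorem allows it to be sliced at fixed height \<open>t\<close> instead.
\<close>

lemma (in prob_space) nn_integral_layer_cake:
  assumes [measurable]: "Z \<in> borel_measurable M" and "AE x in M. 0 \<le> Z x"
  shows "(\<integral>\<^sup>+x. ennreal (Z x) \<partial>M) =
    (\<integral>\<^sup>+t. ennreal (indicator {0..} t * prob {x \<in> space M. t < Z x}) \<partial>lborel)"
proof -
  interpret P: pair_sigma_finite M lborel ..
  have "(\<integral>\<^sup>+x. ennreal (Z x) \<partial>M) =
      (\<integral>\<^sup>+x. (\<integral>\<^sup>+t. indicator {t. 0 \<le> t \<and> t < Z x} t \<partial>lborel) \<partial>M)"
  proof (rule nn_integral_cong_AE, use assms(2) in eventually_elim)
    case (elim x)
    have "{t. 0 \<le> t \<and> t < Z x} = {0..<Z x}" by auto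
    with elim show ?case by simp
  qed
  also have "\<dots> = (\<integral>\<^sup>+t. (\<integral>\<^sup>+x. indicator {t. 0 \<le> t \<and> t < Z x} t \<partial>M) \<partial>lborel)"
    by (rule P.Fubini'[symmetric]) (simp add: indicator_def)
  also have "\<dots> = (\<integral>\<^sup>+t. ennreal (indicator {0..} t * prob {x \<in> space M. t < Z x}) \<partial>lborel)"
  proof (rule nn_integral_cong)
    fix t :: real
    have "(\<integral>\<^sup>+x. indicator {t. 0 \<le> t \<and> t < Z x} t \<partial>M) =
        (\<integral>\<^sup>+x. indicator {0..} t * indicator {x \<in> space M. t < Z x} x \<partial>M)"
      by (rule nn_integral_cong) (auto simp: indicator_def)
    also have "\<dots> = indicator {0..} t * emeasure M {x \<in> space M. t < Z x}"
      by (rule nn_integral_cmult_indicator) measurable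
    finally show "(\<integral>\<^sup>+x. indicator {t. 0 \<le> t \<and> t < Z x} t \<partial>M) =
        ennreal (indicator {0..} t * prob {x \<in> space M. t < Z x})"
      by (simp add: emeasure_eq_measure indicator_def)
  qed
  finally show ?thesis .
qed

text \<open>
  The equivalence is used in both directions: from left to right it makes the tail of \<open>X\<close>
  integrable, and from right to left it carries integrability over from powers of this tail to
  the minima.
\<close>

lemma (in prob_space) has_bochner_integral_layer_cake:
  assumes [measurable]: "Z \<in> borel_measurable M" and nn: "AE x in M. 0 \<le> Z x"
  shows "has_bochner_integral M Z c \<longleftrightarrow>
    has_bochner_integral lborel (\<lambda>t. indicator {0..} t * prob {x \<in> space M. t < Z x}) c"
    (is "_ \<longleftrightarrow> has_bochner_integral _ ?g _")
proof -
  have [measurable]: "?g \<in> borel_measurable lborel"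
    by measurable
  have hbi: "has_bochner_integral N f c \<longleftrightarrow> 0 \<le> c \<and> (\<integral>\<^sup>+x. ennreal (f x) \<partial>N) = ennreal c"
    if "f \<in> borel_measurable N" "AE x in N. 0 \<le> f x" for N :: "'c measure" and f
  proof
    show "has_bochner_integral N f c" if "0 \<le> c \<and> (\<integral>\<^sup>+x. ennreal (f x) \<partial>N) = ennreal c"
      using that \<open>f \<in> borel_measurable N\<close> \<open>AE x in N. 0 \<le> f x\<close>
      by (intro has_bochner_integral_nn_integral) auto
  next
    assume "has_bochner_integral N f c"
    then have "integrable N f" "integral\<^sup>L N f = c"
      by (simp_all add: has_bochner_integral_iff)
    then show "0 \<le> c \<and> (\<integral>\<^sup>+x. ennreal (f x) \<partial>N) = ennreal c"
      using nn_integral_eq_integral[of N f] integral_nonneg_AE[of f N] that by simp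
  qed
  show ?thesis
    using nn by (simp add: hbi nn_integral_layer_cake)
qed

lemma prob_min_order_stat_greater:
  assumes "prob_space M" and [measurable]: "X \<in> borel_measurable M" and "1 \<le> m"
  shows "measure (sample_space M X m) {x \<in> space (sample_space M X m). t < order_stat 1 m x}
    = (1 - cdf (distr M borel X) t) ^ m"
proof -
  interpret M: prob_space M by fact
  interpret D: prob_space "distr M borel X" by (rule M.prob_space_distr) measurable
  interpret S: finite_product_prob_space "\<lambda>_. distr M borel X" "{1..m}"
    by standard simp
  have "order_stat 1 m x = Min (x ` {1..m})" for x
    using order_stat_1[OF \<open>1 \<le> m\<close>] .
  moreover have "{1..m} \<noteq> {}" using \<open>1 \<le> m\<close> by simp
  ultimately have "{x \<in> space (sample_space M X m). t < order_stat 1 m x} = (\<Pi>\<^sub>E i\<in>{1..m}. {t<..})"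
    by (auto simp: sample_space_def space_PiM PiE_iff extensional_def)
  also have "measure (sample_space M X m) \<dots> = (\<Prod>i\<in>{1..m}. measure (distr M borel X) {t<..})"
    unfolding sample_space_def by (rule S.finite_measure_PiM_emb) simp
  also have "measure (distr M borel X) {t<..} = 1 - cdf (distr M borel X) t"
    using D.prob_compl[of "{..t}"] by (simp add: cdf_def Compl_eq_Diff_UNIV[symmetric] not_le)
  finally show ?thesis by simp
qed

theorem mainTheorem2:
  fixes M :: "'a measure" and X :: "'a \<Rightarrow> real" and f :: "real \<Rightarrow> ennreal"
    and F :: "real \<Rightarrow> real"
  assumes "prob_space M"
    and nonneg: "AE \<omega> in M. 0 \<le> X \<omega>"
    and abs_cont: "distributed M lborel X f"
    and F_def: "F = cdf (distr M borel X)"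
    and finite_mean: "integrable M X"
    and lim: "((\<lambda>x. - x * F x * ln (F x)) \<longlongrightarrow> 0) at_top"
  shows "set_integrable lborel {0..} (\<lambda>x. F x * ln (F x))
      \<and> (\<forall>n\<ge>1. integrable (sample_space M X (n + 1)) (order_stat 1 (n + 1)))
      \<and> summable (\<lambda>n. 1 / (real (Suc n) * real (Suc n + 1)) * mean_order_stat M X 1 (Suc n + 1))
      \<and> cumulative_entropy M X =
          - (\<Sum>n. 1 / (real (Suc n) * real (Suc n + 1)) * mean_order_stat M X 1 (Suc n + 1))
          + (\<integral>\<omega>. X \<omega> \<partial>M)"
proof -
  interpret M: prob_space M by fact
  have X [measurable]: "X \<in> borel_measurable M"
    using finite_mean by (rule borel_measurable_integrable)
  let ?D = "distr M borel X"
  interpret D: real_distribution ?D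
    by (rule M.real_distribution_distr) measurable
  have F: "0 \<le> F t" "F t \<le> 1" for t
    unfolding F_def by (simp_all add: D.cdf_nonneg D.cdf_bounded_prob)
  have [measurable]: "F \<in> borel_measurable borel"
    unfolding F_def by (rule borel_measurable_mono) (simp add: mono_def D.cdf_nondecreasing)
  define G where "G m t = indicator {0..} t * (1 - F t) ^ m" for m and t :: real
  have [measurable]: "G m \<in> borel_measurable borel" for m
    unfolding G_def by measurable
  have G_bounds: "0 \<le> G m t" "m \<ge> 1 \<Longrightarrow> G m t \<le> G 1 t" for m t
    using F[of t] power_decreasing[of 1 m "1 - F t"] by (auto simp: G_def indicator_def)
  have "M.prob {x \<in> space M. t < X x} = 1 - F t" for t
  proof -
    have "M.prob {x \<in> space M. t < X x} = M.prob (space M - {x \<in> space M. X x \<le> t})"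
      by (rule arg_cong[where f = M.prob]) auto
    also have "\<dots> = 1 - F t"
    proof -
      have "{x \<in> space M. X x \<le> t} \<in> M.events" by measurable
      then show ?thesis
        by (subst M.prob_compl)
           (simp_all add: F_def cdf_def measure_distr vimage_def Int_def conj_commute)
    qed
    finally show ?thesis .
  qed
  then have mean: "has_bochner_integral lborel (G 1) (\<integral>\<omega>. X \<omega> \<partial>M)"
    using M.has_bochner_integral_layer_cake[OF X nonneg, of "\<integral>\<omega>. X \<omega> \<partial>M"]
      has_bochner_integral_integrable[OF finite_mean]
    by (simp add: G_def[abs_def])
  have G_int: "integrable lborel (G m)" if "m \<ge> 1" for m
    using has_bochner_integral_iff[THEN iffD1, OF mean, THEN conjunct1]
    by (rule Bochner_Integration.integrable_bound) (use G_bounds that in auto)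
  have order: "has_bochner_integral (sample_space M X m) (order_stat 1 m) (\<integral>t. G m t \<partial>lborel)"
    if "m \<ge> 1" for m
  proof -
    interpret S: prob_space "sample_space M X m"
      unfolding sample_space_def by (rule prob_space_PiM) (rule D.prob_space_axioms)
    have "sets (sample_space M X m) = sets (\<Pi>\<^sub>M i\<in>{1..m}. borel)"
      unfolding sample_space_def by (rule sets_PiM_cong) auto
    then have meas: "order_stat 1 m \<in> borel_measurable (sample_space M X m)"
      using measurable_order_stat[of 1 m] that measurable_cong_sets by blast
    have "AE y in ?D. 0 \<le> y"
      using nonneg by (simp add: AE_distr_iff)
    then have "AE x in sample_space M X m. 0 \<le> x i" if "i \<in> {1..m}" for i
      unfolding sample_space_def using that D.prob_space_axioms by (intro AE_PiM_component) auto
    then have "AE x in sample_space M X m. \<forall>i\<in>{1..m}. 0 \<le> x i"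
      by (intro AE_finite_allI) auto
    then have "AE x in sample_space M X m. 0 \<le> order_stat 1 m x"
      by eventually_elim (use that order_stat_1[OF that] in auto)
    then show ?thesis
      using S.has_bochner_integral_layer_cake[OF meas] has_bochner_integral_integrable[OF G_int[OF that]]
        prob_min_order_stat_greater[OF \<open>prob_space M\<close> X that]
      by (simp add: G_def[abs_def] F_def)
  qed
  then have mean_order: "mean_order_stat M X 1 m = (\<integral>t. G m t \<partial>lborel)" if "m \<ge> 1" for m
    using that by (simp add: mean_order_stat_def has_bochner_integral_integral_eq)
  let ?c = "\<lambda>n. 1 / (real (Suc n) * real (Suc n + 1))"
  \<comment> \<open>The value \<open>1\<close> is the expansion at \<open>u = 0\<close>, where all powers are \<open>1\<close>.\<close>
  have c_sum: "?c sums 1"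
    using sums_entropy_expansion[of 0] by simp
  have expand: "(\<lambda>n. ?c n * G (Suc n + 1) t) sums (G 1 t + indicator {0..} t * (F t * ln (F t)))" for t
    using sums_mult[OF sums_entropy_expansion[OF F, of t], of "indicator {0..} t"]
    unfolding G_def by (cases "0 \<le> t") simp_all
  let ?s = "\<lambda>t. \<Sum>n. ?c n * G (Suc n + 1) t"
  have int: "integrable lborel (\<lambda>t. ?c n * G (Suc n + 1) t)" for n
    using G_int by simp
  have ae: "AE t in lborel. summable (\<lambda>n. norm (?c n * G (Suc n + 1) t))"
    using expand G_bounds(1) by (auto simp: sums_iff abs_mult)
  \<comment> \<open>The domination \<open>G m \<le> G 1\<close> justifies integrating the expansion term by term.\<close>
  have "summable (\<lambda>n. ?c n * (\<integral>t. G 1 t \<partial>lborel))"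
    using c_sum by (intro summable_mult2) (rule sums_summable)
  then have sm: "summable (\<lambda>n. \<integral>t. norm (?c n * G (Suc n + 1) t) \<partial>lborel)"
  proof (rule summable_comparison_test'[where N = 0])
    fix n
    have "(\<integral>t. G (Suc n + 1) t \<partial>lborel) \<le> (\<integral>t. G 1 t \<partial>lborel)"
      by (intro integral_mono G_int G_bounds) auto
    then show "norm (\<integral>t. norm (?c n * G (Suc n + 1) t) \<partial>lborel) \<le> ?c n * (\<integral>t. G 1 t \<partial>lborel)"
      using G_bounds(1) by (simp add: abs_mult divide_right_mono)
  qed
  have sums: "(\<lambda>n. ?c n * mean_order_stat M X 1 (Suc n + 1)) sums (\<integral>t. ?s t \<partial>lborel)"
    using sums_integral[OF int ae sm] mean_order by simp
  have eq: "indicator {0..} t * (F t * ln (F t)) = ?s t - G 1 t" for t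
    using expand[of t] by (simp add: sums_iff)
  have s_int: "integrable lborel ?s"
    using integrable_suminf[OF int ae sm] .
  have ent: "set_integrable lborel {0..} (\<lambda>x. F x * ln (F x))"
    unfolding set_integrable_def real_scaleR_def eq
    using s_int G_int[of 1] by simp
  have "cumulative_entropy M X = - (\<integral>t. ?s t - G 1 t \<partial>lborel)"
    unfolding cumulative_entropy_def set_lebesgue_integral_def real_scaleR_def F_def[symmetric] eq ..
  also have "\<dots> = - (\<integral>t. ?s t \<partial>lborel) + (\<integral>\<omega>. X \<omega> \<partial>M)"
    using s_int G_int[of 1] mean by (simp add: has_bochner_integral_integral_eq)
  finally show ?thesis
    using ent order sums by (auto simp: sums_iff has_bochner_integral_iff)
qed

end
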